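(* Let $\mathbf{S}$ be a completely simple semigroup and let $\rho,\sigma,\delta$ be congruences on $\mathbf{S}$. Then $C(\rho,\sigma;\delta)$ if and only if $[\rho,\sigma]\le\delta$.
   Context: A completely simple semigroup is a simple semigroup (no proper ideals) containing a primitive idempotent, i.e. an element $e$ such that $x=e$ is the unique solution of $ex=xe=x=x^2$. $\mathbb{N}=\{1,2,\dots\}$. For an algebra $\mathbf{A}$ and congruences $\alpha,\beta,\delta$ of $\mathbf{A}$, $C(\alpha,\beta;\delta)$ ("$\alpha$ centralizes $\beta$ modulo $\delta$") means: for all $n\in\mathbb{N}$, all $(n+1)$-ary term functions $t$ of $\mathbf{A}$, all $a,b\in A$ and $\mathbf{c},\mathbf{d}\in A^n$ with $a\,\alpha\,b$ and $c_i\,\beta\,d_i$ for every $i$, $t(a,\mathbf{c})\,\delta\,t(a,\mathbf{d})$ implies $t(b,\mathbf{c})\,\delta\,t(b,\mathbf{d})$. The commutator $[\alpha,\beta]$ is the least congruence $\delta$ with $C(\alpha,\beta;\delta)$. Semigroups are algebras with one binary operation. Congruences are ordered by inclusion. *)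

theory Defs
  imports Main
begin

text \<open>Semigroups are types of class \<^class>\<open>semigroup_mult\<close>; the underlying set is the whole type.
  The notions from commutator theory only need the algebra's single binary operation.\<close>

text \<open>Ideals are nonempty by convention, so that a simple semigroup can exist at all.\<close>

definition (in semigroup_mult) semigroup_ideal :: "'a set \<Rightarrow> bool" where
  "semigroup_ideal I \<longleftrightarrow> I \<noteq> {} \<and> (\<forall>s. \<forall>x\<in>I. s * x \<in> I \<and> x * s \<in> I)"

text \<open>That \<open>e\<close> is idempotent is the instance \<open>x = e\<close>.\<close>

definition (in semigroup_mult) primitive_idempotent :: "'a \<Rightarrow> bool" where
  "primitive_idempotent e \<longleftrightarrow> (\<forall>x. (e * x = x \<and> x * e = x \<and> x = x * x) \<longleftrightarrow> x = e)"

class simple_semigroup = semigroup_mult +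
  assumes semigroup_ideal_eq_UNIV: "semigroup_ideal I \<Longrightarrow> I = UNIV"

class completely_simple_semigroup = simple_semigroup +
  assumes ex_primitive_idempotent: "\<exists>e. primitive_idempotent e"

definition congruence :: "'a::times rel \<Rightarrow> bool" where
  "congruence r \<longleftrightarrow> equiv UNIV r \<and>
     (\<forall>a b c d. (a, b) \<in> r \<longrightarrow> (c, d) \<in> r \<longrightarrow> (a * c, b * d) \<in> r)"

text \<open>The \<open>k\<close>-ary term functions. A \<open>k\<close>-tuple is represented by a function on \<^typ>\<open>nat\<close> of which
  only the values at \<open>0, \<dots>, k - 1\<close> matter.\<close>

inductive term_function :: "nat \<Rightarrow> ((nat \<Rightarrow> 'a::times) \<Rightarrow> 'a) \<Rightarrow> bool" for k where
  proj: "i < k \<Longrightarrow> term_function k (\<lambda>x. x i)"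
| mult: "term_function k s \<Longrightarrow> term_function k t \<Longrightarrow> term_function k (\<lambda>x. s x * t x)"

text \<open>In \<open>C(\<alpha>,\<beta>;\<delta>)\<close> the tuple \<open>(a, c\<^sub>1, \<dots>, c\<^sub>n)\<close> is represented by \<open>c(0 := a)\<close>.\<close>

definition centralizes :: "'a::times rel \<Rightarrow> 'a rel \<Rightarrow> 'a rel \<Rightarrow> bool" where
  "centralizes \<alpha> \<beta> \<delta> \<longleftrightarrow>
     (\<forall>n\<ge>1. \<forall>t. term_function (n + 1) t \<longrightarrow>
       (\<forall>a b c d. (a, b) \<in> \<alpha> \<longrightarrow> (\<forall>i\<in>{1..n}. (c i, d i) \<in> \<beta>) \<longrightarrow>
         (t (c(0 := a)), t (d(0 := a))) \<in> \<delta> \<longrightarrow> (t (c(0 := b)), t (d(0 := b))) \<in> \<delta>))"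

definition commutator :: "'a::times rel \<Rightarrow> 'a rel \<Rightarrow> 'a rel" where
  "commutator \<alpha> \<beta> = (LEAST \<delta>. congruence \<delta> \<and> centralizes \<alpha> \<beta> \<delta>)"

text \<open>The least such congruence exists, so \<^const>\<open>Least\<close> denotes it.\<close>

lemma congruence_Inter:
  assumes "\<And>r. r \<in> R \<Longrightarrow> congruence r"
  shows "congruence (\<Inter>R)"
  unfolding congruence_def
proof (intro conjI equivI allI impI)
  have eq: "equiv UNIV r" if "r \<in> R" for r
    using assms[OF that] by (simp add: congruence_def)
  show "refl (\<Inter>R)"
    using eq by (simp add: equiv_def refl_on_def)
  show "sym (\<Inter>R)"
    using eq by (meson InterE InterI equivE symE symI)
  show "trans (\<Inter>R)"
    using eq by (meson InterE InterI equivE transE transI)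
  show "(a * c, b * d) \<in> \<Inter>R" if "(a, b) \<in> \<Inter>R" "(c, d) \<in> \<Inter>R" for a b c d
    using that assms by (simp add: congruence_def)
qed simp

lemma centralizes_Inter:
  assumes "\<And>\<delta>. \<delta> \<in> D \<Longrightarrow> centralizes \<alpha> \<beta> \<delta>"
  shows "centralizes \<alpha> \<beta> (\<Inter>D)"
  unfolding centralizes_def
proof (intro allI impI InterI)
  fix n t a b c d \<delta>
  assume "1 \<le> n" "term_function (n + 1) t" "(a, b) \<in> \<alpha>" "\<forall>i\<in>{1..n}. (c i, d i) \<in> \<beta>"
    "(t (c(0 := a)), t (d(0 := a))) \<in> \<Inter>D" "\<delta> \<in> D"
  then show "(t (c(0 := b)), t (d(0 := b))) \<in> \<delta>"
    using assms[OF \<open>\<delta> \<in> D\<close>, unfolded centralizes_def, rule_format, of n t a b c d] by blast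
qed

lemma commutator_eq_Inter:
  "commutator \<alpha> \<beta> = \<Inter>{\<delta>. congruence \<delta> \<and> centralizes \<alpha> \<beta> \<delta>}"
  unfolding commutator_def
proof (rule Least_equality)
  show "congruence (\<Inter>{\<delta>. congruence \<delta> \<and> centralizes \<alpha> \<beta> \<delta>}) \<and>
      centralizes \<alpha> \<beta> (\<Inter>{\<delta>. congruence \<delta> \<and> centralizes \<alpha> \<beta> \<delta>})"
    by (rule conjI; rule congruence_Inter centralizes_Inter; simp)
qed (rule Inter_lower, simp)

end

theory Submission
  imports Defs
begin

text \<open>
  A congruence \<open>\<delta>\<close> above the commutator inherits \<open>C(\<rho>,\<sigma>;\<delta>)\<close> from it, because on a completely
  simple semigroup the term condition survives enlarging the third congruence
  (\<open>centralizes_mono\<close>). The reason is that such a semigroup is a group up to rectangular-band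
  coordinates. Fix a primitive idempotent \<open>e\<close>. Then \<open>eSe\<close> is a group
  (\<open>primitive_idempotent_local_inverse\<close>), and an element \<open>u\<close> is determined, even modulo \<open>\<delta>\<close>, by
  its principal right ideal, its principal left ideal and the group element \<open>eue\<close>
  (\<open>congruent_if_local\<close>).

  Suppose that \<open>t(a,c) \<delta> t(a,d)\<close>. The right ideal generated by the value of a term depends only
  on its first letter. Either this letter is the first variable, which takes the same value
  \<open>b\<close> in \<open>t(b,c)\<close> and \<open>t(b,d)\<close>, or it is some \<open>c\<^sub>i\<close> respectively \<open>d\<^sub>i\<close>, whose right ideals are
  already identified modulo \<open>\<delta>\<close> by the hypothesis on \<open>a\<close>. The left ideals are dealt with by the
  last letter. So only \<open>e t(b,c) e \<delta> e t(b,d) e\<close> remains, and this is the argument for groups.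
  Write \<open>w(x,y) = e t(x,y) e\<close> and apply the term condition modulo \<open>\<gamma> \<subseteq> \<delta>\<close> to \<open>w(x,y) y'\<close>, where
  \<open>y'\<close> takes the \<open>\<sigma>\<close>-related values \<open>w(a,c)\<inverse>\<close> and \<open>w(a,d)\<inverse>\<close>. Inversion need not be a term function,
  but the inverses enter as values of one more variable. At \<open>x = a\<close> both products equal
  \<open>e\<close>, so at \<open>x = b\<close> they are \<open>\<gamma>\<close>-related. Cancelling \<open>w(a,c) \<delta> w(a,d)\<close> gives the claim.
\<close>

section \<open>Congruences and term functions\<close>

lemma congruence_refl: "congruence r \<Longrightarrow> (x, x) \<in> r"
  by (simp add: congruence_def equiv_def refl_on_def)

lemma congruence_sym: "congruence r \<Longrightarrow> (x, y) \<in> r \<Longrightarrow> (y, x) \<in> r"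
  by (meson congruence_def equivE symE)

lemma congruence_trans: "congruence r \<Longrightarrow> (x, y) \<in> r \<Longrightarrow> (y, z) \<in> r \<Longrightarrow> (x, z) \<in> r"
  by (meson congruence_def equivE transE)

lemma congruence_mult:
  "congruence r \<Longrightarrow> (a, b) \<in> r \<Longrightarrow> (c, d) \<in> r \<Longrightarrow> (a * c, b * d) \<in> r"
  by (auto simp: congruence_def)

lemma term_function_mono:
  assumes "term_function k t" "k \<le> l"
  shows "term_function l t"
  using assms by induction (auto intro: term_function.intros)

lemma term_function_cong:
  assumes "term_function k t" "\<And>i. i < k \<Longrightarrow> x i = y i"
  shows "t x = t y"
  using assms by induction auto

lemma term_function_congruence:
  assumes "term_function k t" "congruence r" "\<And>i. i < k \<Longrightarrow> (x i, y i) \<in> r"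
  shows "(t x, t y) \<in> r"
  using assms by induction (auto intro: congruence_mult)

section \<open>The local group at a primitive idempotent\<close>

lemma primitive_idempotent_idem:
  fixes e :: "'a::semigroup_mult"
  shows "primitive_idempotent e \<Longrightarrow> e * e = e"
  unfolding primitive_idempotent_def by metis

lemma simple_semigroup_factor:
  fixes x y :: "'a::simple_semigroup"
  shows "\<exists>p q. x = p * y * q"
proof -
  have "semigroup_ideal {p * y * q | p q. True}"
    unfolding semigroup_ideal_def
  proof (intro conjI allI ballI)
    fix s z
    assume "z \<in> {p * y * q | p q. True}"
    then obtain p q where z: "z = p * y * q"
      by blast
    have "s * z = (s * p) * y * q" "z * s = p * y * (q * s)"
      by (simp_all add: z mult.assoc)
    then show "s * z \<in> {p * y * q | p q. True}" "z * s \<in> {p * y * q | p q. True}"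
      by blast+
  qed blast
  from semigroup_ideal_eq_UNIV[OF this] show ?thesis
    by blast
qed

text \<open>Simplicity writes \<open>e = p (exe) q\<close> with \<open>p, q \<in> eSe\<close>. Then \<open>(exe) q p\<close> and \<open>q p (exe)\<close>
  are idempotents below \<open>e\<close>, so by primitivity both are \<open>e\<close>.\<close>

lemma primitive_idempotent_local_inverse:
  fixes e x :: "'a::simple_semigroup"
  assumes e: "primitive_idempotent e"
  shows "\<exists>g. e * g = g \<and> g * e = g \<and> g * (e * x * e) = e \<and> (e * x * e) * g = e"
proof -
  have ee: "e * e = e" "\<And>z. e * (e * z) = e * z"
    using primitive_idempotent_idem[OF e] by (auto simp: mult.assoc[symmetric])
  have prim: "f = e" if "e * f = f" "f * e = f" "f * f = f" for f
    using e that unfolding primitive_idempotent_def by metis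
  define X where "X = e * x * e"
  obtain p q where pq: "e = p * X * q"
    using simple_semigroup_factor by blast
  define P Q where "P = e * p * e" and "Q = e * q * e"
  have absorb: "e * X = X" "X * e = X" "e * P = P" "P * e = P" "e * Q = Q" "Q * e = Q"
    by (simp_all add: X_def P_def Q_def mult.assoc ee)
  have "e = e * (p * X * q) * e"
    unfolding pq[symmetric] by (simp only: ee)
  also have "\<dots> = P * X * Q"
    by (simp add: X_def P_def Q_def mult.assoc ee)
  finally have PXQ: "P * (X * Q) = e"
    by (simp add: mult.assoc)
  have absorb': "e * (X * z) = X * z" "e * (P * z) = P * z" "e * (Q * z) = Q * z"
      "P * (X * (Q * z)) = e * z" for z
    by (simp_all only: mult.assoc[symmetric] absorb PXQ[unfolded mult.assoc[symmetric]])
  have "X * (Q * P) = e"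
    by (rule prim) (simp_all add: mult.assoc absorb absorb')
  moreover have "(Q * P) * X = e"
    by (rule prim) (simp_all add: mult.assoc absorb absorb' PXQ)
  ultimately show ?thesis
    unfolding X_def[symmetric]
    by (intro exI[of _ "Q * P"]) (simp add: mult.assoc absorb absorb')
qed

text \<open>All principal right ideals are minimal: write \<open>x = p e q\<close> and invert \<open>e q r e\<close>.\<close>

lemma ex_right_cancel:
  fixes x r :: "'a::completely_simple_semigroup"
  shows "\<exists>q. x = x * r * q"
proof -
  obtain e :: 'a where e: "primitive_idempotent e"
    using ex_primitive_idempotent by blast
  obtain p q where x: "x = p * e * q"
    using simple_semigroup_factor by blast
  obtain g where "e * (q * r) * e * g = e"
    using primitive_idempotent_local_inverse[OF e] by blast
  then have "x = x * r * (e * g * q)"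
    unfolding x by (metis mult.assoc)
  then show ?thesis ..
qed

lemma ex_left_cancel:
  fixes x r :: "'a::completely_simple_semigroup"
  shows "\<exists>q. x = q * r * x"
proof -
  obtain e :: 'a where e: "primitive_idempotent e"
    using ex_primitive_idempotent by blast
  obtain p q where x: "x = p * e * q"
    using simple_semigroup_factor by blast
  obtain g where "g * (e * (r * p) * e) = e"
    using primitive_idempotent_local_inverse[OF e] by blast
  then have "x = (p * g * e) * r * x"
    unfolding x by (metis mult.assoc)
  then show ?thesis ..
qed

text \<open>Let \<open>g\<close> be the inverse of \<open>eue\<close> in \<open>eSe\<close>. The idempotents \<open>uge\<close> and \<open>egu\<close> are a left identity
  on \<open>uS\<close> and a right identity on \<open>Su\<close>, whence modulo \<open>\<delta>\<close>
  \<open>v = (uge) v (egu) = u g (eve) g u = u g (eue) g u = u\<close>.\<close>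

lemma congruent_if_local:
  fixes u v e :: "'a::completely_simple_semigroup"
  assumes \<delta>: "congruence \<delta>" and e: "primitive_idempotent e"
    and local: "(e * u * e, e * v * e) \<in> \<delta>"
    and right: "(v, u * r) \<in> \<delta>" and left: "(v, s * u) \<in> \<delta>"
  shows "(u, v) \<in> \<delta>"
proof -
  note [intro] = congruence_refl[OF \<delta>] congruence_mult[OF \<delta>]
  note tr [trans] = congruence_trans[OF \<delta>]
  note sym = congruence_sym[OF \<delta>]
  obtain g where g: "e * g = g" "g * e = g" "g * (e * u * e) = e" "(e * u * e) * g = e"
    using primitive_idempotent_local_inverse[OF e] by blast
  obtain p where p: "u = p * e * u"
    using ex_left_cancel by blast
  obtain q where q: "u = u * e * q"
    using ex_right_cancel by blast
  have "u * g * e * u = p * ((e * u * e) * g) * e * u"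
    using p g by (metis mult.assoc)
  also have "\<dots> = u"
    using g(4) p primitive_idempotent_idem[OF e] by (metis mult.assoc)
  finally have ugu: "u * g * e * u = u" .
  then have uR: "u * g * e * (u * r) = u * r"
    by (metis mult.assoc)
  have uL: "(s * u) * (e * g * u) = s * u"
    using ugu g by (metis mult.assoc)
  have "(v, u * r) \<in> \<delta>"
    by (rule right)
  also have "(u * r, u * g * e * v) \<in> \<delta>"
    using sym[OF congruence_mult[OF \<delta> congruence_refl[OF \<delta>] right], of "u * g * e"] uR by simp
  also have "(u * g * e * v, u * g * e * (s * u)) \<in> \<delta>"
    using left by blast
  also have "u * g * e * (s * u) = u * g * e * ((s * u) * (e * g * u))"
    by (simp only: uL)
  also have "(\<dots>, u * g * e * (v * (e * g * u))) \<in> \<delta>"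
    using sym[OF left] by blast
  also have "u * g * e * (v * (e * g * u)) = (u * g) * (e * v * e) * (g * u)"
    by (simp only: mult.assoc)
  also have "(\<dots>, (u * g) * (e * u * e) * (g * u)) \<in> \<delta>"
    using sym[OF local] by blast
  also have "(u * g) * (e * u * e) * (g * u) = u"
    using g ugu by (metis mult.assoc)
  finally show ?thesis
    by (rule sym)
qed

section \<open>First and last letters of terms\<close>

text \<open>With \<open>x i\<close> the first letter, \<open>t x\<close> and \<open>x i\<close> generate the same right ideal,
  since that of \<open>x i\<close> is minimal.\<close>

lemma term_function_first_letter:
  fixes t :: "(nat \<Rightarrow> 'a::completely_simple_semigroup) \<Rightarrow> 'a"
  assumes "term_function k t"
  shows "\<exists>i<k. \<forall>x. \<exists>r q. t x = x i * r \<and> x i = t x * q"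
proof -
  have "\<exists>i<k. \<forall>x. \<exists>r. t x = x i * r"
    using assms
  proof induction
    case (proj i)
    have "\<exists>r. y = y * r" for y :: 'a
      using ex_right_cancel mult.assoc by metis
    with proj show ?case
      by blast
  next
    case (mult s t)
    then show ?case
      by (metis mult.assoc)
  qed
  then show ?thesis
    using ex_right_cancel by metis
qed

lemma term_function_last_letter:
  fixes t :: "(nat \<Rightarrow> 'a::completely_simple_semigroup) \<Rightarrow> 'a"
  assumes "term_function k t"
  shows "\<exists>i<k. \<forall>x. \<exists>r q. t x = r * x i \<and> x i = q * t x"
proof -
  have "\<exists>i<k. \<forall>x. \<exists>r. t x = r * x i"
    using assms
  proof induction
    case (proj i)
    have "\<exists>r. y = r * y" for y :: 'a
      using ex_left_cancel by metis
    with proj show ?case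
      by blast
  next
    case (mult s t)
    then show ?case
      by (metis mult.assoc)
  qed
  then show ?thesis
    using ex_left_cancel mult.assoc by metis
qed

text \<open>The tuples stand for \<open>x = (a,c)\<close>, \<open>y = (a,d)\<close>, \<open>x' = (b,c)\<close>, \<open>y' = (b,d)\<close>. Whichever
  position the first letter has, its values in \<open>x'\<close> and \<open>y'\<close> generate the same right ideal
  modulo \<open>\<delta>\<close>.\<close>

lemma term_function_right_ideal_transfer:
  fixes t :: "(nat \<Rightarrow> 'a::completely_simple_semigroup) \<Rightarrow> 'a"
  assumes t: "term_function k t" and \<delta>: "congruence \<delta>" and xy: "(t x, t y) \<in> \<delta>"
    and entries: "\<And>i. i < k \<Longrightarrow> x' i = y' i \<or> x' i = x i \<and> y' i = y i"
  shows "\<exists>r. (t y', t x' * r) \<in> \<delta>"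
proof -
  obtain i where i: "i < k" and first: "\<And>x. \<exists>r q. t x = x i * r \<and> x i = t x * q"
    using term_function_first_letter[OF t] by blast
  obtain r where r: "t y' = y' i * r"
    using first by blast
  from entries[OF i] have "\<exists>m. (y' i, t x' * m) \<in> \<delta>"
  proof
    assume "x' i = y' i"
    then show ?thesis
      using first congruence_refl[OF \<delta>] by metis
  next
    assume same: "x' i = x i \<and> y' i = y i"
    obtain q where q: "y i = t y * q"
      using first by blast
    obtain m where m: "t x = x i * m"
      using first by blast
    obtain n where n: "x' i = t x' * n"
      using first by blast
    have "(t y * q, t x * q) \<in> \<delta>"
      using xy \<delta> by (blast intro: congruence_mult congruence_sym congruence_refl)
    then have "(y' i, t x' * (n * m * q)) \<in> \<delta>"
      using same q m n by (metis mult.assoc)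
    then show ?thesis ..
  qed
  then obtain m where "(y' i, t x' * m) \<in> \<delta>" ..
  then have "(y' i * r, t x' * m * r) \<in> \<delta>"
    using \<delta> by (blast intro: congruence_mult congruence_refl)
  then show ?thesis
    unfolding r mult.assoc by blast
qed

lemma term_function_left_ideal_transfer:
  fixes t :: "(nat \<Rightarrow> 'a::completely_simple_semigroup) \<Rightarrow> 'a"
  assumes t: "term_function k t" and \<delta>: "congruence \<delta>" and xy: "(t x, t y) \<in> \<delta>"
    and entries: "\<And>i. i < k \<Longrightarrow> x' i = y' i \<or> x' i = x i \<and> y' i = y i"
  shows "\<exists>r. (t y', r * t x') \<in> \<delta>"
proof -
  obtain i where i: "i < k" and last: "\<And>x. \<exists>r q. t x = r * x i \<and> x i = q * t x"
    using term_function_last_letter[OF t] by blast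
  obtain r where r: "t y' = r * y' i"
    using last by blast
  from entries[OF i] have "\<exists>m. (y' i, m * t x') \<in> \<delta>"
  proof
    assume "x' i = y' i"
    then show ?thesis
      using last congruence_refl[OF \<delta>] by metis
  next
    assume same: "x' i = x i \<and> y' i = y i"
    obtain q where q: "y i = q * t y"
      using last by blast
    obtain m where m: "t x = m * x i"
      using last by blast
    obtain n where n: "x' i = n * t x'"
      using last by blast
    have "(q * t y, q * t x) \<in> \<delta>"
      using xy \<delta> by (blast intro: congruence_mult congruence_sym congruence_refl)
    then have "(y' i, (q * m * n) * t x') \<in> \<delta>"
      using same q m n by (metis mult.assoc)
    then show ?thesis ..
  qed
  then obtain m where "(y' i, m * t x') \<in> \<delta>" ..
  then have "(r * y' i, r * (m * t x')) \<in> \<delta>"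
    using \<delta> by (blast intro: congruence_mult congruence_refl)
  then show ?thesis
    unfolding r mult.assoc[symmetric] by blast
qed

section \<open>Enlarging the third congruence\<close>

text \<open>If \<open>g\<close> and \<open>h\<close> invert \<open>u\<close> and \<open>v\<close>, then \<open>g = g (v h)\<close> is related to \<open>(g u) h = h\<close>.\<close>

lemma congruence_local_inverse:
  fixes e u v :: "'a::semigroup_mult"
  assumes r: "congruence r" and uv: "(u, v) \<in> r"
    and "g * e = g" "g * u = e" and "e * h = h" "v * h = e"
  shows "(g, h) \<in> r"
proof -
  have "(g * v * h, g * u * h) \<in> r"
    using r uv by (blast intro: congruence_mult congruence_sym congruence_refl)
  then show ?thesis
    using assms by (simp add: mult.assoc[of g v h])
qed

text \<open>Any two choices of further \<open>\<sigma>\<close>-related arguments \<open>p \<sigma> p'\<close> may be appended to the tuples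
  \<open>c\<close>, \<open>d\<close>. A constant \<open>z\<close> is a pair of equal arguments.\<close>

lemma centralizes_product:
  fixes \<rho> \<sigma> \<gamma> :: "'a::semigroup_mult rel"
  assumes cent: "centralizes \<rho> \<sigma> \<gamma>" and \<sigma>: "congruence \<sigma>" and t: "term_function (n + 1) t"
    and ab: "(a, b) \<in> \<rho>" and cd: "\<forall>i\<in>{1..n}. (c i, d i) \<in> \<sigma>" and p: "(p, p') \<in> \<sigma>"
    and eq: "(z * t (c(0 := a)) * z * p, z * t (d(0 := a)) * z * p') \<in> \<gamma>"
  shows "(z * t (c(0 := b)) * z * p, z * t (d(0 := b)) * z * p') \<in> \<gamma>"
proof -
  define T where "T = (\<lambda>x. x (n + 1) * t x * x (n + 1) * x (n + 2))"
  have T: "term_function ((n + 2) + 1) T"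
    unfolding T_def
    by (intro term_function.intros term_function_mono[OF t]) simp_all
  define C where "C = c(n + 1 := z, n + 2 := p)"
  define D where "D = d(n + 1 := z, n + 2 := p')"
  have t_eq: "t (C(0 := x)) = t (c(0 := x))" "t (D(0 := x)) = t (d(0 := x))" for x
    by (rule term_function_cong[OF t]; simp add: C_def D_def)+
  have T_eq: "T (C(0 := x)) = z * t (c(0 := x)) * z * p"
      "T (D(0 := x)) = z * t (d(0 := x)) * z * p'" for x
    by (simp_all add: T_def t_eq) (simp_all add: C_def D_def)
  have CD: "\<forall>i\<in>{1..n + 2}. (C i, D i) \<in> \<sigma>"
    using cd p congruence_refl[OF \<sigma>] by (auto simp: C_def D_def)
  have "(T (C(0 := b)), T (D(0 := b))) \<in> \<gamma>"
    using cent[unfolded centralizes_def, rule_format, of "n + 2" T a b C D] T ab CD eq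
    by (simp add: T_eq)
  then show ?thesis
    by (simp add: T_eq)
qed

lemma centralizes_mono:
  fixes \<rho> \<sigma> \<gamma> \<delta> :: "'a::completely_simple_semigroup rel"
  assumes \<sigma>: "congruence \<sigma>" and \<gamma>: "congruence \<gamma>" and \<delta>: "congruence \<delta>"
    and cent: "centralizes \<rho> \<sigma> \<gamma>" and sub: "\<gamma> \<subseteq> \<delta>"
  shows "centralizes \<rho> \<sigma> \<delta>"
  unfolding centralizes_def
proof (intro allI impI)
  fix n t a b c d
  assume t: "term_function (n + 1) t" and ab: "(a, b) \<in> \<rho>"
    and cd: "\<forall>i\<in>{1..n}. (c i, d i) \<in> \<sigma>"
    and eq: "(t (c(0 := a)), t (d(0 := a))) \<in> \<delta>"
  obtain e :: 'a where e: "primitive_idempotent e"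
    using ex_primitive_idempotent by blast
  define u v where "u = e * t (c(0 := a)) * e" and "v = e * t (d(0 := a)) * e"
  define u' v' where "u' = e * t (c(0 := b)) * e" and "v' = e * t (d(0 := b)) * e"
  obtain g where g: "g * e = g" "g * u = e" "u * g = e"
    unfolding u_def using primitive_idempotent_local_inverse[OF e] by blast
  obtain h where h: "e * h = h" "h * v = e" "v * h = e"
    unfolding v_def using primitive_idempotent_local_inverse[OF e] by blast
  have uv_\<delta>: "(u, v) \<in> \<delta>"
    unfolding u_def v_def by (intro congruence_mult congruence_refl \<delta> eq)
  have "(t (c(0 := a)), t (d(0 := a))) \<in> \<sigma>"
    using cd congruence_refl[OF \<sigma>] by (intro term_function_congruence[OF t \<sigma>]) simp
  then have "(u, v) \<in> \<sigma>"
    unfolding u_def v_def by (intro congruence_mult congruence_refl \<sigma>)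
  then have gh: "(g, h) \<in> \<sigma>"
    using congruence_local_inverse[OF \<sigma>] g h by blast
  have "(u * g, v * h) \<in> \<gamma>"
    using g h congruence_refl[OF \<gamma>] by simp
  then have "(u' * g, v' * h) \<in> \<gamma>"
    using centralizes_product[OF cent \<sigma> t ab cd gh, of e] by (simp add: u_def v_def u'_def v'_def)
  then have "(u' * g * u, v' * h * v) \<in> \<delta>"
    using sub uv_\<delta> congruence_mult[OF \<delta>] by blast
  moreover have "u' * e = u'" "v' * e = v'"
    by (simp_all add: u'_def v'_def mult.assoc primitive_idempotent_idem[OF e])
  ultimately have local: "(u', v') \<in> \<delta>"
    by (simp add: mult.assoc g h)
  have entries: "(c(0 := b)) i = (d(0 := b)) i \<or>
      (c(0 := b)) i = (c(0 := a)) i \<and> (d(0 := b)) i = (d(0 := a)) i" for i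
    by simp
  obtain r where "(t (d(0 := b)), t (c(0 := b)) * r) \<in> \<delta>"
    using term_function_right_ideal_transfer[OF t \<delta> eq entries] by blast
  moreover obtain s where "(t (d(0 := b)), s * t (c(0 := b))) \<in> \<delta>"
    using term_function_left_ideal_transfer[OF t \<delta> eq entries] by blast
  ultimately show "(t (c(0 := b)), t (d(0 := b))) \<in> \<delta>"
    using congruent_if_local[OF \<delta> e local[unfolded u'_def v'_def]] by blast
qed

theorem proposition5p2:
  fixes \<rho> \<sigma> \<delta> :: "'a::completely_simple_semigroup rel"
  assumes "congruence \<rho>" and "congruence \<sigma>" and "congruence \<delta>"
  shows "centralizes \<rho> \<sigma> \<delta> \<longleftrightarrow> commutator \<rho> \<sigma> \<subseteq> \<delta>"
proof
  assume "centralizes \<rho> \<sigma> \<delta>"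
  then show "commutator \<rho> \<sigma> \<subseteq> \<delta>"
    unfolding commutator_eq_Inter using assms(3) by (intro Inter_lower) simp
next
  have "congruence (commutator \<rho> \<sigma>)" "centralizes \<rho> \<sigma> (commutator \<rho> \<sigma>)"
    unfolding commutator_eq_Inter by (rule congruence_Inter centralizes_Inter; simp)+
  moreover assume "commutator \<rho> \<sigma> \<subseteq> \<delta>"
  ultimately show "centralizes \<rho> \<sigma> \<delta>"
    using centralizes_mono assms(2,3) by blast
qed

end
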